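(* Let $X$ be (the vertex set of) an infinite simple connected graph, equipped with the shortest path distance, which supports at least one doubling measure, and such that $|B(x,r)|=|B(y,r)|$ for all $x,y\in X$ and all $r>0$. Then the counting measure $\#_X$ belongs to $\mathrm{DM}(X)$, i.e. $\#_X$ is doubling and $C_{\#_X}=C_X$.
   Context: For a metric space $(X,d)$, write $B(x,r)=\{y\in X: d(y,x)<r\}$. A Borel regular measure $\mu$ on $X$ is doubling if there is a constant $C>0$ with $\mu(B(x,2r))\le C\mu(B(x,r))$ for all $x\in X$, $r>0$, and $0<\mu(B(x_0,r_0))<\infty$ for some $x_0\in X$, $r_0>0$ (then $0<\mu(B(x,r))<\infty$ for all $x\in X$, $r>0$). Its doubling constant is $C_\mu=\sup_{x\in X,\,r>0}\mu(B(x,2r))/\mu(B(x,r))$. The least doubling constant of $X$ is $C_X=\inf_\mu C_\mu$, the infimum being over all doubling measures on $X$. The set of doubling minimizers is $\mathrm{DM}(X)=\{\mu \text{ doubling measure on } X: C_\mu=C_X\}$. A graph is identified with its vertex set and $|A|$ denotes the cardinality of $A$. *)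

theory Defs
  imports
    "HOL-Analysis.Analysis"
    "HOL-Library.Equipollence"
    "Graph_Theory.Shortest_Path"
    "Graph_Theory.Digraph_Component"
begin

section \<open>Doubling measures on a metric space\<close>

context Metric_space
begin

definition borel_subsets :: "'a set set" where
  "borel_subsets = sigma_sets M {U. openin mtopology U}"

text \<open>
  The \<open>\<sigma>\<close>-algebra of \<open>\<mu>\<close> may be larger than the Borel one, so that the restriction of
  a Borel regular outer measure to its Caratheodory measurable sets is covered as well as a measure
  defined on the Borel sets only.
\<close>

definition borel_regular :: "'a measure \<Rightarrow> bool" where
  "borel_regular \<mu> \<longleftrightarrow>
     space \<mu> = M \<and>
     borel_subsets \<subseteq> sets \<mu> \<and>
     (\<forall>A\<in>sets \<mu>. \<exists>B\<in>borel_subsets. A \<subseteq> B \<and> emeasure \<mu> A = emeasure \<mu> B)"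

definition doubling_measure :: "'a measure \<Rightarrow> bool" where
  "doubling_measure \<mu> \<longleftrightarrow>
     borel_regular \<mu> \<and>
     (\<exists>C::real. C > 0 \<and>
        (\<forall>x\<in>M. \<forall>r>0. emeasure \<mu> (mball x (2 * r)) \<le> ennreal C * emeasure \<mu> (mball x r))) \<and>
     (\<exists>x\<^sub>0\<in>M. \<exists>r\<^sub>0>0. 0 < emeasure \<mu> (mball x\<^sub>0 r\<^sub>0) \<and> emeasure \<mu> (mball x\<^sub>0 r\<^sub>0) < \<infinity>)"

definition doubling_constant :: "'a measure \<Rightarrow> ennreal" where
  "doubling_constant \<mu> =
     (SUP x\<in>M. SUP r\<in>{0<..}. emeasure \<mu> (mball x (2 * r)) / emeasure \<mu> (mball x r))"

definition least_doubling_constant :: ennreal where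
  "least_doubling_constant = (INF \<mu>\<in>{\<mu>. doubling_measure \<mu>}. doubling_constant \<mu>)"

definition doubling_minimizers :: "'a measure set" where
  "doubling_minimizers =
     {\<mu>. doubling_measure \<mu> \<and> doubling_constant \<mu> = least_doubling_constant}"

end

section \<open>Graphs as metric spaces\<close>

text \<open>
  A simple graph, finite or infinite, is a \<^const>\<open>pair_bidirected_digraph\<close>: its arcs form a
  symmetric irreflexive relation on its vertices, an edge being a pair of opposite arcs.
  With unit weights the cost of a walk is its number of edges, so that the infimum
  \<open>wf_digraph.\<mu>\<close> of the costs of all walks is the shortest path distance
  (infinite if there is no walk, which \<^const>\<open>real_of_ereal\<close> turns into \<open>0\<close>).
\<close>

definition path_dist :: "'a pair_pre_digraph \<Rightarrow> 'a \<Rightarrow> 'a \<Rightarrow> real" where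
  "path_dist G x y = real_of_ereal (wf_digraph.\<mu> (with_proj G) (\<lambda>_. 1) x y)"

context pair_bidirected_digraph
begin

lemma awalk_cost_unit: "awalk_cost (\<lambda>_. 1) p = real (length p)"
  by (induction p) auto

lemma path_dist_le:
  assumes "awalk x p y"
  shows "path_dist G x y \<le> real (length p)"
proof -
  have "\<mu> (\<lambda>_. 1) x y \<le> ereal (real (length p))"
    using min_cost_le_walk_cost[OF assms, of "\<lambda>_. 1"] by (simp add: awalk_cost_unit)
  moreover have "0 \<le> \<mu> (\<lambda>_. 1) x y"
    unfolding \<mu>_def by (rule INF_greatest) (simp add: awalk_cost_unit)
  ultimately show ?thesis
    unfolding path_dist_def by (cases "\<mu> (\<lambda>_. 1) x y") auto
qed

lemma path_dist_attained:
  assumes "awalk x p0 y"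
  obtains p where "awalk x p y" "path_dist G x y = real (length p)"
proof -
  obtain p where p: "awalk x p y" "\<And>q. awalk x q y \<Longrightarrow> length p \<le> length q"
    using assms ex_has_least_nat[of "\<lambda>q. awalk x q y" p0 length] by auto
  have "\<mu> (\<lambda>_. 1) x y = ereal (real (length p))"
    unfolding \<mu>_def
    by (rule antisym) (use p in \<open>auto intro!: INF_lower2[of p] INF_greatest simp: awalk_cost_unit\<close>)
  then show thesis
    using p(1) that by (simp add: path_dist_def)
qed

lemma path_dist_nonneg: "0 \<le> path_dist G x y"
  unfolding path_dist_def \<mu>_def
  by (intro real_of_ereal_pos INF_greatest) (simp add: awalk_cost_unit)

lemma path_dist_commute: "path_dist G x y = path_dist G y x"
proof -
  have *: "\<mu> (\<lambda>_. 1) x y \<le> \<mu> (\<lambda>_. 1) y x" for x y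
    unfolding \<mu>_def
  proof (rule INF_greatest)
    fix p assume "p \<in> {p. awalk y p x}"
    then have "awalk x (rev_path p) y" by simp
    moreover have "length (rev_path p) = length p" by (induction p) auto
    ultimately show "(INF p\<in>{p. awalk x p y}. ereal (awalk_cost (\<lambda>_. 1) p))
        \<le> ereal (awalk_cost (\<lambda>_. 1) p)"
      by (intro INF_lower2[of "rev_path p"]) (auto simp: awalk_cost_unit)
  qed
  show ?thesis
    unfolding path_dist_def using antisym[OF *[of x y] *[of y x]] by simp
qed

lemma connected_awalk:
  assumes "Digraph_Component.connected (with_proj G)" "x \<in> pverts G" "y \<in> pverts G"
  obtains p where "awalk x p y"
proof -
  have "strongly_connected (with_proj G)"
    using symmetric_connected_imp_strongly_connected[OF pair_sym_arcs assms(1)] .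
  then have "x \<rightarrow>\<^sup>*\<^bsub>with_proj G\<^esub> y"
    using assms(2,3) by (auto simp: strongly_connected_def)
  then show thesis
    using that reachable_awalk by auto
qed

lemma Metric_space_path_dist:
  assumes conn: "Digraph_Component.connected (with_proj G)"
  shows "Metric_space (pverts G) (path_dist G)"
proof
  fix x y
  show "0 \<le> path_dist G x y" by (rule path_dist_nonneg)
  show "path_dist G x y = path_dist G y x" by (rule path_dist_commute)
next
  fix x y assume xy: "x \<in> pverts G" "y \<in> pverts G"
  show "path_dist G x y = 0 \<longleftrightarrow> x = y"
  proof
    assume "path_dist G x y = 0"
    moreover obtain p where "awalk x p y" "path_dist G x y = real (length p)"
      using connected_awalk[OF conn xy] path_dist_attained by metis
    ultimately show "x = y" by (auto simp: awalk_Nil_iff)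
  next
    assume "x = y"
    then have "awalk x [] y" using xy by (simp add: awalk_Nil_iff)
    then show "path_dist G x y = 0"
      using path_dist_le path_dist_nonneg[of x y] by fastforce
  qed
next
  fix x y z assume "x \<in> pverts G" "y \<in> pverts G" "z \<in> pverts G"
  then obtain p q where "awalk x p y" "path_dist G x y = real (length p)"
      "awalk y q z" "path_dist G y z = real (length q)"
    using connected_awalk[OF conn] path_dist_attained by metis
  then show "path_dist G x z \<le> path_dist G x y + path_dist G y z"
    using path_dist_le[OF awalk_appendI, of x p y q z] by simp
qed

end

end

theory Submission
  imports Defs "HOL-Real_Asymp.Real_Asymp"
begin

text \<open>
  Let \<open>\<mu>\<close> be a doubling measure whose balls satisfy \<open>\<mu> (B(x,2r)) \<le> C \<mu> (B(x,r))\<close>, and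
  let \<open>b(r)\<close> be the common cardinality of the balls of radius \<open>r\<close>; these are finite, because
  in a doubling space whose distinct points have distance at least \<open>1\<close> every point of a ball
  carries at least a fixed fraction of the measure of that ball.  Everything rests on
  \<open>b(2r) \<le> C b(r)\<close>, which says that counting measure satisfies the doubling inequality with every
  constant that works for some \<open>\<mu>\<close>.  In particular it does so with the doubling constant of \<open>\<mu>\<close>,
  which is itself such a constant because balls have positive finite measure.

  To compare \<open>b\<close> with \<open>\<mu>\<close>, sum the doubling inequality over the centres \<open>x\<close> in a large ball
  \<open>B(p,s+2r)\<close> and exchange the order of summation (\<open>sum_mball_swap_le\<close>).  A point \<open>y\<close> lies in
  \<open>B(x,R)\<close> for exactly those \<open>x\<close> that lie in \<open>B(y,R)\<close>, hence is counted \<open>b(R)\<close> times unless it is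
  close to the boundary of the large ball.  This gives
  \<open>b(2r) \<mu> (B(p,s)) \<le> C b(r) \<mu> (B(p,s+3r))\<close>
  for all \<open>s > 0\<close>.  The boundary effect, that is the passage from \<open>s\<close> to \<open>s+3r\<close>, costs nothing:
  a doubling measure grows at most polynomially, so that \<open>\<mu> (B(p,s+3r)) / \<mu> (B(p,s))\<close> cannot stay
  above a constant exceeding \<open>1\<close> (\<open>doubling_growth_factor_le_1\<close>).
\<close>

section \<open>Growth of doubling functions\<close>

text \<open>
  Iterating the additive step gives exponential growth with base \<open>c\<close>, iterating the doubling step
  only polynomial growth; so \<open>c > 1\<close> is impossible.
\<close>

lemma doubling_growth_factor_le_1:
  fixes f :: "real \<Rightarrow> real"
  assumes pos: "\<And>s. s > 0 \<Longrightarrow> f s > 0"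
    and mono: "\<And>s t. 0 < s \<Longrightarrow> s \<le> t \<Longrightarrow> f s \<le> f t"
    and doubling: "\<And>s. s > 0 \<Longrightarrow> f (2 * s) \<le> C * f s"
    and step: "\<And>s. s > 0 \<Longrightarrow> c * f s \<le> f (s + a)"
    and "C > 0" "a > 0"
  shows "c \<le> 1"
proof (rule ccontr)
  assume "\<not> c \<le> 1"
  then have c: "c > 1" by simp
  have lower: "c ^ n * f 1 \<le> f (1 + real n * a)" for n
  proof (induction n)
    case (Suc n)
    have "c ^ Suc n * f 1 \<le> c * f (1 + real n * a)"
      using Suc c by simp
    also have "\<dots> \<le> f (1 + real n * a + a)"
      using \<open>a > 0\<close> by (intro step) (simp add: add_pos_nonneg)
    finally show ?case by (simp add: algebra_simps)
  qed simp
  have upper: "f (2 ^ k * (1 + a)) \<le> C ^ k * f (1 + a)" for k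
  proof (induction k)
    case (Suc k)
    have "f (2 ^ Suc k * (1 + a)) \<le> C * f (2 ^ k * (1 + a))"
      using doubling[of "2 ^ k * (1 + a)"] \<open>a > 0\<close> by (simp add: mult.assoc)
    also have "\<dots> \<le> C * (C ^ k * f (1 + a))"
      using Suc \<open>C > 0\<close> by simp
    finally show ?case by simp
  qed simp
  have "c ^ (2 ^ k) * f 1 \<le> C ^ k * f (1 + a)" for k
  proof -
    have "1 + real (2 ^ k) * a \<le> 2 ^ k * (1 + a)"
      by (simp add: algebra_simps)
    then have "f (1 + real (2 ^ k) * a) \<le> f (2 ^ k * (1 + a))"
      using \<open>a > 0\<close> by (intro mono) (simp_all add: add_pos_nonneg)
    with lower[of "2 ^ k"] upper[of k] show ?thesis by linarith
  qed
  then have "ln (c ^ (2 ^ k) * f 1) \<le> ln (C ^ k * f (1 + a))" for k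
    using c \<open>C > 0\<close> \<open>a > 0\<close> pos by (intro ln_mono) auto
  then have bound: "2 ^ k * ln c + ln (f 1) \<le> real k * ln C + ln (f (1 + a))" for k
    using c \<open>C > 0\<close> \<open>a > 0\<close> pos[of 1] pos[of "1 + a"] by (simp add: ln_mult ln_realpow)
  have "filterlim (\<lambda>k. 2 ^ k * ln c + ln (f 1) - (real k * ln C + ln (f (1 + a)))) at_top at_top"
    using ln_gt_zero[OF c] by real_asymp
  then have "\<forall>\<^sub>F k in sequentially.
      0 < 2 ^ k * ln c + ln (f 1) - (real k * ln C + ln (f (1 + a)))"
    unfolding filterlim_at_top_dense by blast
  then obtain k where "0 < 2 ^ k * ln c + ln (f 1) - (real k * ln C + ln (f (1 + a)))"
    using eventually_happens'[OF sequentially_bot] by blast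
  with bound[of k] show False by linarith
qed

section \<open>Doubling measures and their balls\<close>

context Metric_space
begin

text \<open>
  Both sides sum over pairs at distance less than \<open>R\<close>; those on the left all occur on the right.
\<close>

lemma sum_mball_swap_le:
  fixes g :: "'a \<Rightarrow> 'a \<Rightarrow> real"
  assumes "finite A" "finite B" "A \<subseteq> M" "\<And>x. x \<in> A \<Longrightarrow> mball x R \<subseteq> B"
    and fin: "\<And>x. x \<in> M \<Longrightarrow> finite (mball x R)" and "B \<subseteq> M"
    and nonneg: "\<And>x y. 0 \<le> g x y"
  shows "(\<Sum>x\<in>A. \<Sum>y\<in>mball x R. g x y) \<le> (\<Sum>y\<in>B. \<Sum>x\<in>mball y R. g x y)"
proof -
  have "(\<Sum>x\<in>A. \<Sum>y\<in>mball x R. g x y) = (\<Sum>(x, y)\<in>(SIGMA x:A. mball x R). g x y)"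
    using assms by (intro sum.Sigma) auto
  also have "\<dots> = (\<Sum>(y, x)\<in>prod.swap ` (SIGMA x:A. mball x R). g x y)"
    by (subst sum.reindex) (auto simp: case_prod_unfold)
  also have "\<dots> \<le> (\<Sum>(y, x)\<in>(SIGMA y:B. mball y R). g x y)"
  proof (rule sum_mono2)
    show "finite (SIGMA y:B. mball y R)"
      using assms by (intro finite_SigmaI) auto
    show "prod.swap ` (SIGMA x:A. mball x R) \<subseteq> (SIGMA y:B. mball y R)"
    proof (rule image_subsetI, elim SigmaE)
      fix z x y
      assume x: "x \<in> A" and y: "y \<in> mball x R" and z: "z = (x, y)"
      then have "y \<in> B" using assms(4) by blast
      moreover have "x \<in> mball y R"
        using y commute[of x y] by simp
      ultimately show "prod.swap z \<in> (SIGMA y:B. mball y R)"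
        using z by simp
    qed
  qed (use nonneg in auto)
  also have "\<dots> = (\<Sum>y\<in>B. \<Sum>x\<in>mball y R. g x y)"
    using assms by (intro sum.Sigma[symmetric]) auto
  finally show ?thesis .
qed

lemma borel_regular_mball:
  assumes "borel_regular \<mu>"
  shows "mball x r \<in> sets \<mu>"
proof -
  have "mball x r \<in> borel_subsets"
    unfolding borel_subsets_def by (rule sigma_sets.Basic) simp
  then show ?thesis
    using assms unfolding borel_regular_def by (elim conjE) (rule subsetD)
qed

lemma emeasure_mball_iterate:
  assumes doubling: "\<And>x r. x \<in> M \<Longrightarrow> r > 0 \<Longrightarrow>
      emeasure \<mu> (mball x (2 * r)) \<le> C * emeasure \<mu> (mball x r)"
    and "x \<in> M" "r > 0"
  shows "emeasure \<mu> (mball x (2 ^ k * r)) \<le> C ^ k * emeasure \<mu> (mball x r)"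
proof (induction k)
  case (Suc k)
  have "emeasure \<mu> (mball x (2 ^ Suc k * r)) \<le> C * emeasure \<mu> (mball x (2 ^ k * r))"
    using doubling[of x "2 ^ k * r"] \<open>x \<in> M\<close> \<open>r > 0\<close> by (simp add: mult.assoc)
  also have "\<dots> \<le> C * (C ^ k * emeasure \<mu> (mball x r))"
    using Suc by (intro mult_left_mono) auto
  finally show ?case by (simp add: mult.assoc)
qed simp

lemma mball_subset_dyadic_mball:
  assumes "x \<in> M" "y \<in> M" "r > 0"
  obtains k where "mball x s \<subseteq> mball y (2 ^ k * r)"
proof -
  obtain k where "(d y x + s) / r < 2 ^ k"
    using real_arch_pow[of 2] by auto
  then have "d y x + s \<le> 2 ^ k * r"
    using \<open>r > 0\<close> by (simp add: field_simps)
  then have "mball x s \<subseteq> mball y (2 ^ k * r)"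
    using assms commute[of x y] by (intro mball_subset) auto
  then show thesis by (rule that)
qed

text \<open>
  One ball of positive finite measure is enough: it lies in a dyadic dilate of any other ball, which
  makes that ball nonnull, and one of its own dilates contains the other ball.
\<close>

lemma doubling_measure_mball:
  assumes "doubling_measure \<mu>" "x \<in> M" "r > 0"
  shows "0 < emeasure \<mu> (mball x r)" "emeasure \<mu> (mball x r) < \<infinity>"
proof -
  obtain C where C: "\<And>x r. x \<in> M \<Longrightarrow> r > 0 \<Longrightarrow>
      emeasure \<mu> (mball x (2 * r)) \<le> ennreal C * emeasure \<mu> (mball x r)"
    using assms(1) unfolding doubling_measure_def by blast
  obtain x0 r0 where x0: "x0 \<in> M" "r0 > 0"
      "0 < emeasure \<mu> (mball x0 r0)" "emeasure \<mu> (mball x0 r0) < \<infinity>"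
    using assms(1) unfolding doubling_measure_def by blast
  have sets: "mball y s \<in> sets \<mu>" for y s
    using assms(1) by (simp add: doubling_measure_def borel_regular_mball)
  obtain k where k: "mball x0 r0 \<subseteq> mball x (2 ^ k * r)"
    using mball_subset_dyadic_mball[OF \<open>x0 \<in> M\<close> \<open>x \<in> M\<close> \<open>r > 0\<close>] .
  have "0 < emeasure \<mu> (mball x0 r0)" by fact
  also have "\<dots> \<le> emeasure \<mu> (mball x (2 ^ k * r))"
    by (intro emeasure_mono k sets)
  also have "\<dots> \<le> ennreal C ^ k * emeasure \<mu> (mball x r)"
    by (intro emeasure_mball_iterate C assms)
  finally show "0 < emeasure \<mu> (mball x r)"
    by (metis mult_zero_right not_gr_zero not_less_zero)
  obtain k where k: "mball x r \<subseteq> mball x0 (2 ^ k * r0)"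
    using mball_subset_dyadic_mball[OF \<open>x \<in> M\<close> \<open>x0 \<in> M\<close> \<open>r0 > 0\<close>] .
  have "emeasure \<mu> (mball x r) \<le> emeasure \<mu> (mball x0 (2 ^ k * r0))"
    by (intro emeasure_mono k sets)
  also have "\<dots> \<le> ennreal C ^ k * emeasure \<mu> (mball x0 r0)"
    by (intro emeasure_mball_iterate C x0)
  also have "\<dots> < \<infinity>"
    using x0 by (simp add: ennreal_mult_less_top ennreal_power[symmetric] power_less_top_ennreal)
  finally show "emeasure \<mu> (mball x r) < \<infinity>" .
qed

lemma emeasure_mball_le_doubling_constant:
  assumes "doubling_measure \<mu>" "x \<in> M" "r > 0"
  shows "emeasure \<mu> (mball x (2 * r)) \<le> doubling_constant \<mu> * emeasure \<mu> (mball x r)"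
proof -
  let ?q = "emeasure \<mu> (mball x (2 * r)) / emeasure \<mu> (mball x r)"
  have "?q \<le> doubling_constant \<mu>"
    unfolding doubling_constant_def using assms by (intro SUP_upper2[of x] SUP_upper) auto
  then have "?q * emeasure \<mu> (mball x r) \<le> doubling_constant \<mu> * emeasure \<mu> (mball x r)"
    by (rule mult_right_mono) simp
  moreover have "?q * emeasure \<mu> (mball x r) = emeasure \<mu> (mball x (2 * r))"
    using doubling_measure_mball[OF assms] by (simp add: ennreal_divide_times)
  ultimately show ?thesis by simp
qed

section \<open>Uniformly discrete spaces\<close>

lemma mball_1_eq_singleton:
  assumes "\<And>x y. x \<in> M \<Longrightarrow> y \<in> M \<Longrightarrow> x \<noteq> y \<Longrightarrow> 1 \<le> d x y" "x \<in> M"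
  shows "mball x 1 = {x}"
  using assms by (force simp: not_less[symmetric])

lemma borel_subsets_uniformly_discrete:
  assumes "\<And>x y. x \<in> M \<Longrightarrow> y \<in> M \<Longrightarrow> x \<noteq> y \<Longrightarrow> 1 \<le> d x y"
  shows "borel_subsets = Pow M"
proof
  show "borel_subsets \<subseteq> Pow M"
    unfolding borel_subsets_def
    using sigma_sets_into_sp[of "{U. openin mtopology U}" M] openin_subset[of mtopology] by auto
  have "openin mtopology U" if "U \<subseteq> M" for U
    using that mball_1_eq_singleton[OF assms] unfolding openin_mtopology
    by (metis bot.extremum insert_subset subsetD zero_less_one)
  then show "Pow M \<subseteq> borel_subsets"
    unfolding borel_subsets_def by (auto intro: sigma_sets.Basic)
qed

text \<open>
  If \<open>2 ^ k\<close> is at least twice the radius \<open>R\<close>, every \<open>y\<close> in the ball \<open>B = B(x,R)\<close> satisfies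
  \<open>\<mu> B \<le> C ^ k \<mu> {y}\<close>; summing this over \<open>y\<close> bounds the cardinality of \<open>B\<close> by \<open>C ^ k\<close>.
\<close>

lemma doubling_measure_finite_mball:
  assumes disc: "\<And>x y. x \<in> M \<Longrightarrow> y \<in> M \<Longrightarrow> x \<noteq> y \<Longrightarrow> 1 \<le> d x y"
    and "doubling_measure \<mu>" "x \<in> M"
  shows "finite (mball x R)"
proof (cases "R > 0")
  case True
  let ?B = "mball x R"
  obtain C where "C > 0" and C: "\<And>x r. x \<in> M \<Longrightarrow> r > 0 \<Longrightarrow>
      emeasure \<mu> (mball x (2 * r)) \<le> ennreal C * emeasure \<mu> (mball x r)"
    using assms(2) unfolding doubling_measure_def by blast
  have sets: "mball y s \<in> sets \<mu>" for y s
    using assms(2) by (simp add: doubling_measure_def borel_regular_mball)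
  obtain k where k: "2 * R < 2 ^ k"
    using real_arch_pow[of 2 "2 * R"] by auto
  have point: "emeasure \<mu> ?B \<le> ennreal C ^ k * emeasure \<mu> {y}" if y: "y \<in> ?B" for y
  proof -
    have "?B \<subseteq> mball y (2 ^ k * 1)"
      using y k by (intro mball_subset) (auto simp: commute)
    then have "emeasure \<mu> ?B \<le> emeasure \<mu> (mball y (2 ^ k * 1))"
      by (intro emeasure_mono sets)
    also have "\<dots> \<le> ennreal C ^ k * emeasure \<mu> (mball y 1)"
      using y by (intro emeasure_mball_iterate C) auto
    finally show ?thesis
      using y mball_1_eq_singleton[OF disc, of y] by simp
  qed
  have "real (card F) \<le> C ^ k" if F: "F \<subseteq> ?B" "finite F" for F
  proof -
    have "of_nat (card F) * emeasure \<mu> ?B = (\<Sum>y\<in>F. emeasure \<mu> ?B)"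
      by simp
    also have "\<dots> \<le> (\<Sum>y\<in>F. ennreal C ^ k * emeasure \<mu> {y})"
      using F by (intro sum_mono point) auto
    also have "\<dots> = ennreal C ^ k * (\<Sum>y\<in>F. emeasure \<mu> {y})"
      by (simp add: sum_distrib_left)
    also have "(\<Sum>y\<in>F. emeasure \<mu> {y}) = emeasure \<mu> F"
    proof (rule emeasure_eq_sum_singleton[symmetric])
      show "{y} \<in> sets \<mu>" if "y \<in> F" for y
        using sets[of y 1] mball_1_eq_singleton[OF disc, of y] F that by auto
    qed (use F in auto)
    also have "emeasure \<mu> F \<le> emeasure \<mu> ?B"
      by (intro emeasure_mono F sets)
    finally have "of_nat (card F) * emeasure \<mu> ?B \<le> ennreal C ^ k * emeasure \<mu> ?B"
      by (simp add: mult_left_mono)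
    then have "of_nat (card F) \<le> ennreal C ^ k"
      using doubling_measure_mball[OF assms(2,3) True]
        ennreal_mult_le_mult_iff[of "emeasure \<mu> ?B" "of_nat (card F)" "ennreal C ^ k"]
      by (simp add: mult.commute zero_less_iff_neq_zero)
    then show ?thesis
      using \<open>C > 0\<close> by (simp add: ennreal_power ennreal_of_nat_eq_real_of_nat)
  qed
  moreover obtain n where "C ^ k \<le> real n"
    using real_arch_simple by blast
  ultimately have "card F \<le> n" if "F \<subseteq> ?B" "finite F" for F
    using that by (meson of_nat_le_iff order_trans)
  then show ?thesis
    using finite_if_finite_subsets_card_bdd[of ?B n] by blast
next
  case False
  then have "mball x R = {}" by (simp add: mball_eq_empty)
  then show ?thesis by simp
qed

text \<open>
  The transfer from \<open>\<mu>\<close> to counting measure: double counting at scale \<open>s\<close> around a fixed centre,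
  followed by \<open>s \<rightarrow> \<infinity>\<close>.
\<close>

lemma card_mball_doubling:
  assumes disc: "\<And>x y. x \<in> M \<Longrightarrow> y \<in> M \<Longrightarrow> x \<noteq> y \<Longrightarrow> 1 \<le> d x y"
    and homogeneous: "\<And>x y r. x \<in> M \<Longrightarrow> y \<in> M \<Longrightarrow> r > 0 \<Longrightarrow> mball x r \<approx> mball y r"
    and "doubling_measure \<mu>"
    and C: "\<And>x r. x \<in> M \<Longrightarrow> r > 0 \<Longrightarrow>
      emeasure \<mu> (mball x (2 * r)) \<le> ennreal C * emeasure \<mu> (mball x r)"
    and "C > 0" "p \<in> M" "r > 0"
  shows "real (card (mball p (2 * r))) \<le> C * real (card (mball p r))"
proof -
  define m where "m y = measure \<mu> {y}" for y
  define f where "f s = (\<Sum>y\<in>mball p s. m y)" for s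
  define b where "b R = real (card (mball p R))" for R
  have m_nonneg: "m y \<ge> 0" for y by (simp add: m_def)
  have fin: "finite (mball x R)" if "x \<in> M" for x R
    using doubling_measure_finite_mball[OF disc assms(3) that] .
  have b: "real (card (mball x R)) = b R" if "x \<in> M" "R > 0" for x R
    using homogeneous[OF that(1) \<open>p \<in> M\<close> that(2)]
    by (auto simp: b_def eqpoll_def dest: bij_betw_same_card)
  have sets: "mball y s \<in> sets \<mu>" for y s
    using assms(3) by (simp add: doubling_measure_def borel_regular_mball)
  have singleton: "{y} \<in> sets \<mu>" "emeasure \<mu> {y} \<noteq> \<infinity>" "0 < emeasure \<mu> {y}" if "y \<in> M" for y
    using sets[of y 1] doubling_measure_mball[OF assms(3) that, of 1]
      mball_1_eq_singleton[OF disc that] by auto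
  have emeasure_mball: "emeasure \<mu> (mball x R) = ennreal (\<Sum>y\<in>mball x R. m y)"
    if "x \<in> M" for x R
  proof -
    have "emeasure \<mu> (mball x R) = (\<Sum>y\<in>mball x R. emeasure \<mu> {y})"
      using fin that singleton by (intro emeasure_eq_sum_singleton) auto
    also have "\<dots> = (\<Sum>y\<in>mball x R. ennreal (m y))"
      using singleton by (intro sum.cong) (auto simp: m_def emeasure_eq_ennreal_measure)
    finally show ?thesis
      by (simp add: m_nonneg)
  qed
  have doubling: "(\<Sum>y\<in>mball x (2 * R). m y) \<le> C * (\<Sum>y\<in>mball x R. m y)"
    if "x \<in> M" "R > 0" for x R
    using C[OF that] \<open>C > 0\<close> that
    by (simp add: emeasure_mball ennreal_mult[symmetric] m_nonneg sum_nonneg ennreal_le_iff)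
  have f_pos: "f s > 0" if "s > 0" for s
    using doubling_measure_mball[OF assms(3) \<open>p \<in> M\<close> that] \<open>p \<in> M\<close>
    by (simp add: emeasure_mball f_def)
  have b_pos: "b R > 0" if "R > 0" for R
    using fin[OF \<open>p \<in> M\<close>] \<open>p \<in> M\<close> that by (auto simp: b_def card_gt_0_iff)
  have count: "b (2 * r) * f s \<le> C * b r * f (s + 3 * r)" if "s > 0" for s
  proof -
    let ?S = "mball p (s + 2 * r)"
    have "b (2 * r) * f s = (\<Sum>y\<in>mball p s. \<Sum>x\<in>mball y (2 * r). m y)"
      using b \<open>r > 0\<close> by (simp add: f_def sum_distrib_left)
    also have "\<dots> \<le> (\<Sum>x\<in>?S. \<Sum>y\<in>mball x (2 * r). m y)"
      using \<open>p \<in> M\<close> by (intro sum_mball_swap_le fin m_nonneg mball_subset) (auto simp: commute)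
    also have "\<dots> \<le> (\<Sum>x\<in>?S. C * (\<Sum>y\<in>mball x r. m y))"
      using \<open>r > 0\<close> by (intro sum_mono doubling) auto
    also have "\<dots> = C * (\<Sum>x\<in>?S. \<Sum>y\<in>mball x r. m y)"
      by (simp add: sum_distrib_left)
    also have "\<dots> \<le> C * (\<Sum>y\<in>mball p (s + 3 * r). \<Sum>x\<in>mball y r. m y)"
      using \<open>p \<in> M\<close> \<open>C > 0\<close>
      by (intro mult_left_mono sum_mball_swap_le fin m_nonneg mball_subset) (auto simp: commute)
    also have "\<dots> = C * b r * f (s + 3 * r)"
      using b \<open>r > 0\<close> by (simp add: f_def sum_distrib_left mult.assoc)
    finally show ?thesis .
  qed
  \<comment> \<open>Each passage from \<open>s\<close> to \<open>s + 3 r\<close> multiplies \<open>f\<close> by at least this quotient.\<close>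
  have "b (2 * r) / (C * b r) \<le> 1"
  proof (rule doubling_growth_factor_le_1[of f C _ "3 * r"])
    show "f s \<le> f t" if "0 < s" "s \<le> t" for s t
      unfolding f_def using that fin[OF \<open>p \<in> M\<close>] m_nonneg
      by (intro sum_mono2 mball_subset_concentric) auto
    show "f (2 * s) \<le> C * f s" if "s > 0" for s
      unfolding f_def using doubling[OF \<open>p \<in> M\<close> that] .
    show "b (2 * r) / (C * b r) * f s \<le> f (s + 3 * r)" if "s > 0" for s
      using count[OF that] \<open>C > 0\<close> b_pos[OF \<open>r > 0\<close>] by (simp add: field_simps)
  qed (use f_pos \<open>C > 0\<close> \<open>r > 0\<close> in auto)
  then show ?thesis
    using \<open>C > 0\<close> b_pos[OF \<open>r > 0\<close>] by (simp add: b_def)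
qed

lemma count_space_doubling_minimizer:
  assumes disc: "\<And>x y. x \<in> M \<Longrightarrow> y \<in> M \<Longrightarrow> x \<noteq> y \<Longrightarrow> 1 \<le> d x y"
    and homogeneous: "\<And>x y r. x \<in> M \<Longrightarrow> y \<in> M \<Longrightarrow> r > 0 \<Longrightarrow> mball x r \<approx> mball y r"
    and "\<exists>\<mu>. doubling_measure \<mu>"
  shows "count_space M \<in> doubling_minimizers"
proof -
  obtain \<mu>0 where \<mu>0: "doubling_measure \<mu>0"
    using assms(3) by blast
  have count: "emeasure (count_space M) (mball x r) = ennreal (real (card (mball x r)))"
    if "x \<in> M" for x r
    using doubling_measure_finite_mball[OF disc \<mu>0 that]
    using mball_subset_mspace
    by (simp add: emeasure_count_space_finite ennreal_of_nat_eq_real_of_nat)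
  have transfer: "emeasure (count_space M) (mball x (2 * r))
      \<le> ennreal C * emeasure (count_space M) (mball x r)"
    if "doubling_measure \<mu>" "C > 0" "x \<in> M" "r > 0" "\<And>x r. x \<in> M \<Longrightarrow> r > 0 \<Longrightarrow>
      emeasure \<mu> (mball x (2 * r)) \<le> ennreal C * emeasure \<mu> (mball x r)" for \<mu> C x r
    using card_mball_doubling[OF disc homogeneous that(1,5,2,3,4)] that(2,3)
    by (simp add: count ennreal_mult[symmetric] ennreal_leI)
  have doubling: "doubling_measure (count_space M)"
    unfolding doubling_measure_def
  proof (intro conjI)
    show "borel_regular (count_space M)"
      using borel_subsets_uniformly_discrete[OF disc] by (auto simp: borel_regular_def)
    show "\<exists>C::real. C > 0 \<and> (\<forall>x\<in>M. \<forall>r>0. emeasure (count_space M) (mball x (2 * r))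
        \<le> ennreal C * emeasure (count_space M) (mball x r))"
      using \<mu>0 transfer[OF \<mu>0] unfolding doubling_measure_def by meson
    obtain x0 where "x0 \<in> M"
      using \<mu>0 unfolding doubling_measure_def by blast
    then show "\<exists>x\<in>M. \<exists>r>0. 0 < emeasure (count_space M) (mball x r)
        \<and> emeasure (count_space M) (mball x r) < \<infinity>"
      using mball_1_eq_singleton[OF disc] by (intro bexI[of _ x0] exI[of _ 1]) auto
  qed
  have "doubling_constant (count_space M) \<le> doubling_constant \<mu>" if \<mu>: "doubling_measure \<mu>" for \<mu>
  proof (cases "doubling_constant \<mu>")
    case (real D)
    have "emeasure (count_space M) (mball x (2 * r)) / emeasure (count_space M) (mball x r)
        \<le> doubling_constant \<mu>" if "x \<in> M" "r > 0" for x r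
    proof -
      have le: "emeasure \<mu> (mball y (2 * s)) \<le> ennreal D * emeasure \<mu> (mball y s)"
        if "y \<in> M" "s > 0" for y s
        using emeasure_mball_le_doubling_constant[OF \<mu> that] real by simp
      have "D > 0"
        using le[OF that] doubling_measure_mball(1)[OF \<mu> \<open>x \<in> M\<close>, of "2 * r"] \<open>r > 0\<close> real(1)
        by (cases "D = 0") auto
      have "emeasure (count_space M) (mball x (2 * r))
          \<le> doubling_constant \<mu> * emeasure (count_space M) (mball x r)"
        using transfer[OF \<mu> \<open>D > 0\<close> that le] real by simp
      then show ?thesis
        using doubling_measure_mball[OF doubling that]
        by (intro divide_le_posI_ennreal) (simp_all add: mult.commute)
    qed
    then show ?thesis
      unfolding doubling_constant_def[of "count_space M"] by (intro SUP_least) auto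
  qed simp
  then have "doubling_constant (count_space M) \<le> least_doubling_constant"
    unfolding least_doubling_constant_def by (intro INF_greatest) auto
  moreover have "least_doubling_constant \<le> doubling_constant (count_space M)"
    unfolding least_doubling_constant_def using doubling by (intro INF_lower) auto
  ultimately show ?thesis
    using doubling by (simp add: doubling_minimizers_def)
qed

end

section \<open>Homogeneous graphs\<close>

lemma (in pair_bidirected_digraph) one_le_path_dist:
  assumes "Digraph_Component.connected (with_proj G)"
    and "x \<in> pverts G" "y \<in> pverts G" "x \<noteq> y"
  shows "1 \<le> path_dist G x y"
proof -
  obtain w where "awalk x w y" and w: "path_dist G x y = real (length w)"
    using connected_awalk[OF assms(1-3)] path_dist_attained by metis
  then have "w \<noteq> []"
    using \<open>x \<noteq> y\<close> by (auto simp: awalk_Nil_iff)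
  then show ?thesis
    using w by (cases w) auto
qed

theorem theorem2:
  fixes G :: "'a pair_pre_digraph"
  assumes "pair_bidirected_digraph G"
    and "Digraph_Component.connected (with_proj G)"
    and "infinite (pverts G)"
    and "\<exists>\<mu>. Metric_space.doubling_measure (pverts G) (path_dist G) \<mu>"
    and "\<And>x y r. x \<in> pverts G \<Longrightarrow> y \<in> pverts G \<Longrightarrow> r > 0 \<Longrightarrow>
           Metric_space.mball (pverts G) (path_dist G) x r
             \<approx> Metric_space.mball (pverts G) (path_dist G) y r"
  shows "count_space (pverts G) \<in> Metric_space.doubling_minimizers (pverts G) (path_dist G)"
proof -
  interpret pair_bidirected_digraph G by fact
  show ?thesis
    using Metric_space.count_space_doubling_minimizer[OF Metric_space_path_dist[OF assms(2)]
        one_le_path_dist[OF assms(2)] assms(5,4)] .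
qed

end
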